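(* Let $k,n$ be integers with $2\le k\le n$, and write $n=a(k-1)+b$ with integers $a>0$ and $0\le b<k-1$. Define $e_{n,2}=2(n-1)$ and, for $k>2$, $$e_{n,k}=\begin{cases} ka-1 & \text{if } b=0 \ (\text{in which case } a\ge 2),\\ ka & \text{if } b=1,\\ ka+b & \text{if } b>1.\end{cases}$$ If $G$ is a strongly connected digraph with $n$ vertices, edge set $E$, and $\mathrm{circ}(G)=k$, then $|E|\ge e_{n,k}$. Moreover, the bound is best possible, i.e., there is a strongly connected digraph $G_0$ with $n$ vertices, $\mathrm{circ}(G_0)=k$ and exactly $e_{n,k}$ edges.
   Context: Digraphs have a finite vertex set $V$ and edge set $E\subseteq V\times V$ (loops are allowed, no multiple edges). A digraph is strongly connected if for every ordered pair of distinct vertices $p,q$ there is a directed path from $p$ to $q$. A cycle is a directed path that begins and ends at the same vertex and intersects itself only at that vertex; its length is its number of edges (a loop is a cycle of length 1). The circumference $\mathrm{circ}(G)$ is the length of the longest cycle in $G$. *)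

theory Defs
  imports "Graph_Theory.Graph_Theory"
begin

(* Digraphs with loops but without multiple arcs are the records of type "pair_pre_digraph"
   satisfying the locale predicate "pair_fin_digraph"; the library notions for general digraphs
   (strongly_connected, cycle) apply to them through the coercion "with_proj".
   A library cycle is a nonempty closed arc walk, so a loop is a cycle of length 1. *)

(* On nat, Sup is the maximum of a nonempty finite set and Sup {} = 0.  In a finite digraph the
   set of cycle lengths is finite, and an acyclic digraph gets circumference 0. *)
definition circumference :: "('a, 'b) pre_digraph \<Rightarrow> nat" where
  "circumference G = Sup (length ` {p. pre_digraph.cycle G p})"

(* Intended for 2 <= k <= n; then n = a * (k - 1) + b is Euclidean division by k - 1 > 0. *)
definition min_arcs :: "nat \<Rightarrow> nat \<Rightarrow> nat" where
  "min_arcs n k =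
    (if k = 2 then 2 * (n - 1)
     else let a = n div (k - 1); b = n mod (k - 1) in
       if b = 0 then k * a - 1
       else if b = 1 then k * a
       else k * a + b)"

lemma min_arcs_eq:
  assumes "2 \<le> k" "n = a * (k - 1) + b" "b < k - 1"
  shows "min_arcs n k =
    (if k = 2 then 2 * (n - 1)
     else if b = 0 then k * a - 1
     else if b = 1 then k * a
     else k * a + b)"
proof -
  have "n div (k - 1) = a" "n mod (k - 1) = b"
    using assms by auto
  then show ?thesis
    by (simp add: min_arcs_def Let_def)
qed

lemma quotient_pos:
  fixes k n a b :: nat
  assumes "2 \<le> k" "k \<le> n" "n = a * (k - 1) + b" "b < k - 1"
  shows "a > 0" and "b = 0 \<Longrightarrow> a \<ge> 2"
proof -
  show "a > 0"
    using assms by (cases a) auto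
  show "a \<ge> 2" if "b = 0"
  proof (rule ccontr)
    assume "\<not> a \<ge> 2"
    then have "a = 0 \<or> a = 1" by auto
    then show False using assms that by auto
  qed
qed

end

theory Submission
  imports Defs
begin

text \<open>Lower bound: grow a strongly connected induced subdigraph, starting from a single vertex, by
  ears. An ear that adds m vertices uses m + 1 new arcs and is closed to a cycle by a path inside
  the current subdigraph, so that m < k. Hence t ears with n - 1 \<le> t * (k - 1) are used, and there
  are at least n - 1 + t arcs; the three cases of the formula are all n - 1 plus (n - 1) / (k - 1)
  rounded up. Equality holds for cycles of length k, the last one possibly shorter, that share a
  single vertex.\<close>

section \<open>Walks and strong connectivity\<close>

text \<open>Turns the distinctness condition in \<open>cycle\<close> into one on the arc list
  alone.\<close>

lemma (in pre_digraph) tl_awalk_verts: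
  assumes "awalk u p v" "p \<noteq> []"
  shows "tl (awalk_verts u p) = map (head G) p"
  using assms by (auto simp: awalk_def dest: awalk_verts_conv')

text \<open>The walk is cut at its first vertex in \<open>S\<close>. The tails of the arcs of
  \<open>q\<close> are its vertices before the last one, so only \<open>v\<close> lies in
  \<open>S\<close>.\<close>

lemma (in wf_digraph) awalk_first_entry:
  assumes "awalk w p s" "s \<in> S" "w \<notin> S"
  obtains q v where "awalk w q v" "v \<in> S" "set (map (tail G) q) \<inter> S = {}"
  using assms
proof (induct p arbitrary: w thesis)
  case Nil
  then show ?case by (auto simp: awalk_Nil_iff)
next
  case (Cons e p)
  then have e: "e \<in> arcs G" "tail G e = w" "awalk (head G e) p s"
    by (auto simp: awalk_Cons_iff)
  show ?case
  proof (cases "head G e \<in> S")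
    case True
    show ?thesis
      using e True Cons.prems by (intro Cons.prems(1)[of "[e]" "head G e"]) (auto simp: awalk_simps)
  next
    case False
    obtain q v where "awalk (head G e) q v" "v \<in> S" "set (map (tail G) q) \<inter> S = {}"
      using Cons.hyps[OF _ e(3) \<open>s \<in> S\<close> False] by blast
    then show ?thesis
      using e Cons.prems by (intro Cons.prems(1)[of "e # q" v]) (auto simp: awalk_simps)
  qed
qed

text \<open>A walk from a vertex of \<open>S\<close> to a vertex outside has to leave
  \<open>S\<close> by some arc.\<close>

lemma (in wf_digraph) strongly_connected_exit_arc:
  assumes "strongly_connected G" "S \<subset> verts G" "S \<noteq> {}"
  obtains e where "e \<in> arcs G" "tail G e \<in> S" "head G e \<notin> S"
proof -
  obtain s z where "s \<in> S" "z \<in> verts G" "z \<notin> S"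
    using assms by auto
  then obtain p where "awalk s p z"
    using assms unfolding strongly_connected_def by (metis psubsetD reachable_awalk)
  then have "\<exists>e \<in> arcs G. tail G e \<in> S \<and> head G e \<notin> S"
    using \<open>s \<in> S\<close> \<open>z \<notin> S\<close>
    by (induct p arbitrary: s) (auto simp: awalk_simps)
  then show thesis using that by blast
qed

text \<open>The vertex \<open>u\<close> is a hub: it is joined both ways to the vertices of
  \<open>S\<close> inside \<open>S\<close>, and to those on the closed walk along that walk.\<close>

lemma (in wf_digraph) strongly_connected_induce_Un_closed_walk:
  assumes scS: "strongly_connected (G \<restriction> S)" and "S \<subseteq> verts G"
    and c: "awalk u c u" and "u \<in> S"
  shows "strongly_connected (G \<restriction> (S \<union> set (awalk_verts u c)))"
proof -
  define T where "T = S \<union> set (awalk_verts u c)"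
  have "T \<subseteq> verts G"
    using c \<open>S \<subseteq> verts G\<close> by (auto simp: T_def)
  interpret T: wf_digraph "G \<restriction> T" by (rule wellformed_induce_subgraph)
  have cT: "T.awalk u c u"
    by (rule awalk_induce[OF c]) (auto simp: T_def)
  have via_u: "x \<rightarrow>\<^sup>*\<^bsub>G \<restriction> T\<^esub> u \<and> u \<rightarrow>\<^sup>*\<^bsub>G \<restriction> T\<^esub> x" if "x \<in> T" for x
  proof (cases "x \<in> S")
    case True
    then have "x \<rightarrow>\<^sup>*\<^bsub>G \<restriction> S\<^esub> u" "u \<rightarrow>\<^sup>*\<^bsub>G \<restriction> S\<^esub> x"
      using scS \<open>u \<in> S\<close> by (auto simp: strongly_connected_def)
    then show ?thesis
      using \<open>T \<subseteq> verts G\<close> by (auto simp: T_def intro: reachable_induce_ss)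
  next
    case False
    then have "x \<in> set (T.awalk_verts u c)"
      using that by (auto simp: T_def awalk_verts_induce)
    then show ?thesis
      using cT T.awalk_verts_reachable_from T.awalk_verts_reachable_to by blast
  qed
  have "strongly_connected (G \<restriction> T)"
  proof
    show "verts (G \<restriction> T) \<noteq> {}" using \<open>u \<in> S\<close> by (auto simp: T_def)
  next
    fix x y assume "x \<in> verts (G \<restriction> T)" "y \<in> verts (G \<restriction> T)"
    then show "x \<rightarrow>\<^sup>*\<^bsub>G \<restriction> T\<^esub> y"
      using via_u by (auto intro: T.reachable_trans)
  qed
  then show ?thesis by (simp add: T_def)
qed

section \<open>Adding and counting ears\<close>

text \<open>The ear is an arc \<open>e\<close> leaving \<open>S\<close> followed by a path
  \<open>q\<close> back to a first vertex \<open>v\<close> in \<open>S\<close>. A path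
  \<open>r\<close> inside \<open>S\<close> from \<open>v\<close> to the tail of \<open>e\<close>
  closes it to a cycle, which bounds \<open>m = length q\<close>.\<close>

lemma (in fin_digraph) ear_extension:
  assumes sc: "strongly_connected G" and S: "S \<subset> verts G" "strongly_connected (G \<restriction> S)"
    and bound: "\<And>p. cycle p \<Longrightarrow> length p \<le> k"
  obtains T m where "S \<subset> T" "T \<subseteq> verts G" "strongly_connected (G \<restriction> T)"
    "card T = card S + m" "m < k" "card (arcs (G \<restriction> S)) + m + 1 \<le> card (arcs (G \<restriction> T))"
proof -
  have "S \<noteq> {}" using S(2) by (auto simp: strongly_connected_def)
  obtain e where e: "e \<in> arcs G" "tail G e \<in> S" "head G e \<notin> S"
    using strongly_connected_exit_arc[OF sc S(1) \<open>S \<noteq> {}\<close>] .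
  define u w where "u = tail G e" and "w = head G e"
  have "u \<in> S" "w \<notin> S" "w \<in> verts G" using e by (auto simp: u_def w_def)
  then obtain p where p: "awalk w p u"
    using sc S(1) unfolding strongly_connected_def by (metis psubsetD reachable_awalk)
  obtain q' v where q': "awalk w q' v" "v \<in> S" "set (map (tail G) q') \<inter> S = {}"
    using awalk_first_entry[OF p \<open>u \<in> S\<close> \<open>w \<notin> S\<close>] .
  \<comment> \<open>A path makes the new vertices distinct; its arcs are among those of
    \<open>q'\<close>, so their tails still avoid \<open>S\<close>.\<close>
  define q where "q = awalk_to_apath q'"
  have q: "apath w q v" "set (map (tail G) q) \<inter> S = {}"
    using q' apath_awalk_to_apath[OF q'(1)] awalk_to_apath_subset[OF q'(1)]
    by (auto simp: q_def)
  have wq: "awalk w q v" using q(1) by (rule awalkI_apath)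
  have "q \<noteq> []" using wq \<open>v \<in> S\<close> \<open>w \<notin> S\<close> by (auto simp: awalk_Nil_iff)
  have verts_q: "awalk_verts w q = map (tail G) q @ [v]"
    using wq \<open>q \<noteq> []\<close> by (auto simp: awalk_verts_conv)
  interpret S: wf_digraph "G \<restriction> S" by (rule wellformed_induce_subgraph)
  \<comment> \<open>Chosen in the induced subdigraph, \<open>r\<close> stays apart from the new
    vertices. For \<open>v = u\<close> it is empty.\<close>
  obtain r where rS: "S.apath v r u"
    using S(2) \<open>u \<in> S\<close> \<open>v \<in> S\<close> by (metis S.reachable_apath induce_subgraph_verts strongly_connectedE)
  have r: "apath v r u"
    by (rule subgraph_apath_imp_apath[OF rS]) (use S(1) in \<open>auto intro: subgraph_induce_subgraphI\<close>)
  have wr: "awalk v r u" using r by (rule awalkI_apath)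
  have verts_r: "set (awalk_verts v r) \<subseteq> S"
    using S.awalkI_apath[OF rS] by (auto simp: S.awalk_conv awalk_verts_induce)
  define c where "c = e # q @ r"
  have c: "awalk u c u"
    using e wq wr by (auto simp: c_def u_def w_def awalk_Cons_iff intro: awalk_appendI)
  have "awalk w (q @ r) u" using wq wr by (rule awalk_appendI)
  then have verts_c: "awalk_verts u c = u # map (tail G) q @ awalk_verts v r"
    using wq \<open>q \<noteq> []\<close> verts_q
    by (auto simp: c_def awalk_verts_append2 u_def[symmetric] w_def[symmetric])
  have "cycle c"
    unfolding cycle_def
  proof (intro exI conjI)
    show "awalk u c u" by (rule c)
    \<comment> \<open>Without the first \<open>u\<close> there remain the tails of \<open>q\<close>,
      outside \<open>S\<close>, and the vertices of \<open>r\<close>, inside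
      \<open>S\<close>.\<close>
    show "distinct (tl (awalk_verts u c))"
      using q r verts_q verts_r unfolding verts_c by (auto simp: apath_def)
  qed (simp add: c_def)
  \<comment> \<open>The arc \<open>e\<close> makes this strict:
    \<open>length c = 1 + length q + length r\<close>.\<close>
  then have "length q < k" using bound[of c] by (simp add: c_def)
  define T where "T = S \<union> set (awalk_verts u c)"
  have T: "T = S \<union> set (map (tail G) q)"
    using verts_r \<open>u \<in> S\<close> by (auto simp: T_def verts_c)
  have dist: "distinct (map (tail G) q)"
    using q(1) verts_q by (auto simp: apath_def)
  have "finite S" using S(1) finite_verts by (auto dest: finite_subset)
  then have card_T: "card T = card S + length q"
    using q(2) dist unfolding T by (subst card_Un_disjoint) (auto simp: distinct_card[OF dist, simplified])
  have "S \<subset> T" using q(2) \<open>q \<noteq> []\<close> unfolding T by (cases q) auto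
  have "T \<subseteq> verts G" using c S(1) by (auto simp: T_def)
  have "set (awalk_verts w q) \<subseteq> T" using verts_q q'(2) by (auto simp: T)
  then have qT: "set q \<subseteq> arcs (G \<restriction> T)"
    using wq by (auto simp: set_awalk_verts)
  have "w \<in> T" using \<open>set (awalk_verts w q) \<subseteq> T\<close> wq by (auto simp: set_awalk_verts)
  then have eT: "e \<in> arcs (G \<restriction> T)"
    using e T by (auto simp: w_def)
  have "finite (arcs (G \<restriction> T))" "finite (arcs (G \<restriction> S))" by auto
  \<comment> \<open>All arcs of the ear are new: the head of \<open>e\<close> and the tails in
    \<open>q\<close> lie outside \<open>S\<close>. The tail of \<open>e\<close> is in
    \<open>S\<close>, so \<open>e\<close> is not in \<open>q\<close>.\<close>
  have "card (arcs (G \<restriction> S)) + (length q + 1) = card (arcs (G \<restriction> S) \<union> insert e (set q))"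
  proof (subst card_Un_disjoint)
    show "arcs (G \<restriction> S) \<inter> insert e (set q) = {}" using e q(2) by auto
    have "distinct q" using dist by (simp add: distinct_map)
    then show "card (arcs (G \<restriction> S)) + (length q + 1) = card (arcs (G \<restriction> S)) + card (insert e (set q))"
      using e(2) q(2) by (subst card_insert_disjoint) (auto simp: distinct_card)
  qed auto
  also have "\<dots> \<le> card (arcs (G \<restriction> T))"
    using qT eT \<open>S \<subset> T\<close> by (intro card_mono) auto
  finally show thesis
    using that[OF \<open>S \<subset> T\<close> \<open>T \<subseteq> verts G\<close> _ card_T \<open>length q < k\<close>]
      strongly_connected_induce_Un_closed_walk[OF S(2) _ c \<open>u \<in> S\<close>] S(1)
    by (auto simp: T_def)
qed

text \<open>Here \<open>t\<close> counts the ears that lead from one vertex to all of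
  \<open>verts G\<close>. Each raises arcs minus vertices, at least -1 at the start, by at least 1
  and adds at most \<open>k - 1\<close> vertices.\<close>

lemma (in fin_digraph) number_of_ears:
  assumes sc: "strongly_connected G" and bound: "\<And>p. cycle p \<Longrightarrow> length p \<le> k"
  obtains t where "card (verts G) + t \<le> card (arcs G) + 1" "card (verts G) \<le> t * (k - 1) + 1"
proof -
  \<comment> \<open>The assumptions on \<open>S\<close> and \<open>t\<close> are the invariant after
    \<open>t\<close> ears; the induction is on the number of vertices not yet covered.\<close>
  have extend: "\<exists>t. card (verts G) + t \<le> card (arcs G) + 1 \<and> card (verts G) \<le> t * (k - 1) + 1"
    if "S \<subseteq> verts G" "strongly_connected (G \<restriction> S)"
      "card S + t \<le> card (arcs (G \<restriction> S)) + 1" "card S \<le> t * (k - 1) + 1" for S t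
    using that
  proof (induct "card (verts G - S)" arbitrary: S t rule: less_induct)
    case less
    show ?case
    proof (cases "S = verts G")
      case True
      have "card (arcs (G \<restriction> S)) \<le> card (arcs G)" by (rule card_mono) auto
      then show ?thesis using less.prems True by (intro exI[of _ t]) auto
    next
      case False
      then have "S \<subset> verts G" using less.prems by auto
      obtain T m where T: "S \<subset> T" "T \<subseteq> verts G" "strongly_connected (G \<restriction> T)"
        "card T = card S + m" "m < k" "card (arcs (G \<restriction> S)) + m + 1 \<le> card (arcs (G \<restriction> T))"
        using ear_extension[OF sc \<open>S \<subset> verts G\<close> less.prems(2) bound] .
      have "card (verts G - T) < card (verts G - S)"
        using T by (intro psubset_card_mono) auto
      moreover have "card T + (t + 1) \<le> card (arcs (G \<restriction> T)) + 1"
        using T less.prems by linarith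
      moreover have "card T \<le> (t + 1) * (k - 1) + 1"
        using T(4,5) less.prems(4) by (simp only: distrib_right)
      ultimately show ?thesis using less.hyps T by blast
    qed
  qed
  obtain v where "v \<in> verts G" using sc by (auto simp: strongly_connected_def)
  have "strongly_connected (G \<restriction> {v})"
    using \<open>v \<in> verts G\<close> by (auto simp: strongly_connected_def reachable_def)
  then show thesis
    using extend[of "{v}" 0] \<open>v \<in> verts G\<close> that by auto
qed

section \<open>Circumference, the closed formula and the lower bound\<close>

lemma (in fin_digraph) length_cycle_le_card_verts:
  assumes "cycle p"
  shows "length p \<le> card (verts G)"
proof -
  obtain u where u: "awalk u p u" "distinct (tl (awalk_verts u p))"
    using assms by (auto simp: cycle_def)
  have "length p = length (tl (awalk_verts u p))" by (simp add: length_awalk_verts)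
  also have "\<dots> = card (set (tl (awalk_verts u p)))" using u(2) by (simp add: distinct_card)
  also have "\<dots> \<le> card (verts G)"
  proof (rule card_mono)
    have "set (tl (awalk_verts u p)) \<subseteq> set (awalk_verts u p)"
      by (cases "awalk_verts u p") auto
    then show "set (tl (awalk_verts u p)) \<subseteq> verts G"
      using u(1) by blast
  qed simp
  finally show ?thesis .
qed

text \<open>On \<open>nat\<close>, \<open>Sup\<close> is an upper bound only of bounded sets; the
  number of vertices supplies the bound.\<close>

lemma (in fin_digraph) length_cycle_le_circumference:
  assumes "cycle p"
  shows "length p \<le> circumference G"
  unfolding circumference_def
proof (rule cSup_upper)
  show "bdd_above (length ` Collect cycle)"
    by (rule bdd_aboveI[of _ "card (verts G)"]) (auto dest: length_cycle_le_card_verts)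
qed (use assms in auto)

text \<open>For positive x, \<open>x / d\<close> rounded up is \<open>(x - 1) div d + 1\<close>;
  with x = \<open>n - 1\<close> this gives one formula that serves both bounds.\<close>

lemma min_arcs_conv:
  assumes "2 \<le> k" "k \<le> n"
  shows "min_arcs n k = n + (n - 2) div (k - 1)"
proof (cases "k = 2")
  case True
  then show ?thesis using assms by (simp add: min_arcs_def)
next
  case False
  define a b where "a = n div (k - 1)" and "b = n mod (k - 1)"
  have n: "n = a * (k - 1) + b" "b < k - 1"
    using assms False unfolding a_def b_def by (simp_all only: div_mult_mod_eq) simp
  note a = quotient_pos[OF assms n]
  obtain d where d: "k = d + 3" using assms False by (metis add.commute le_Suc_ex le_antisym not_less_eq_eq numeral_2_eq_2 numeral_3_eq_3)
  obtain a' where a': "a = Suc a'" using a(1) by (cases a) auto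
  \<comment> \<open>Subtracting 2 from \<open>n\<close> borrows a block of size \<open>k - 1\<close>
    exactly if \<open>b < 2\<close>, so the quotient is \<open>a - 1\<close> in the first two cases
    and \<open>a\<close> in the third.\<close>
  consider "b = 0" | "b = 1" | "b \<ge> 2" by linarith
  then show ?thesis
  proof cases
    case 1
    have "n - 2 = a' * (d + 2) + d" using n 1 a' d by simp
    then have "(n - 2) div (k - 1) = a'"
      using d by (intro div_nat_eqI) auto
    then show ?thesis using min_arcs_eq[OF assms(1) n] n 1 a' d by (simp add: algebra_simps)
  next
    case 2
    have "n - 2 = a' * (d + 2) + (d + 1)" using n 2 a' d by simp
    then have "(n - 2) div (k - 1) = a'"
      using d by (intro div_nat_eqI) auto
    then show ?thesis using min_arcs_eq[OF assms(1) n] n 2 a' d by (simp add: algebra_simps)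
  next
    case 3
    have "n - 2 = a * (d + 2) + (b - 2)" using n(1) 3 d by simp
    then have "(n - 2) div (k - 1) = a"
      using n(2) d by (intro div_nat_eqI) auto
    then show ?thesis using min_arcs_eq[OF assms(1) n] n 3 d by (simp add: algebra_simps)
  qed
qed

lemma (in fin_digraph) card_arcs_ge:
  assumes "strongly_connected G" "2 \<le> k" "k \<le> card (verts G)" "circumference G \<le> k"
  shows "min_arcs (card (verts G)) k \<le> card (arcs G)"
proof -
  obtain t where t: "card (verts G) + t \<le> card (arcs G) + 1" "card (verts G) \<le> t * (k - 1) + 1"
    using number_of_ears[OF assms(1)] assms(4) length_cycle_le_circumference le_trans by metis
  \<comment> \<open>With at least two vertices, subtracting 2 instead of 1 makes the bound strict,
    so \<open>t\<close> exceeds the rounded-down quotient.\<close>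
  have "card (verts G) - 2 < t * (k - 1)"
    using t(2) assms(2,3) by linarith
  then have "(card (verts G) - 2) div (k - 1) < t"
    using less_mult_imp_div_less by blast
  then show ?thesis
    using t(1) min_arcs_conv[OF assms(2,3)] by linarith
qed

section \<open>The extremal digraph\<close>

text \<open>The vertices 1, ..., n - 1 are cut into consecutive runs of length d (the last one possibly shorter), each
  of which forms one cycle with 0.\<close>
definition flower :: "nat \<Rightarrow> nat \<Rightarrow> nat pair_pre_digraph" where
  "flower n d = \<lparr>pverts = {..<n},
    parcs = (\<lambda>j. (if d dvd j then 0 else j, Suc j)) ` {..<n - 1}
      \<union> (\<lambda>j. (j, 0)) ` {j \<in> {1..n - 1}. d dvd j \<or> j = n - 1}\<rparr>"

lemma pverts_flower [simp]: "pverts (flower n d) = {..<n}"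
  by (simp add: flower_def)

lemma pair_fin_digraph_flower: "pair_fin_digraph (flower n d)"
  by unfold_locales (auto simp: flower_def split: if_splits)

text \<open>There are \<open>n - 1\<close> arcs into nonzero vertices and one return arc per run.
  The general lower bound later turns this into equality.\<close>

lemma card_parcs_flower_le:
  assumes "2 \<le> n" "1 \<le> d"
  shows "card (parcs (flower n d)) \<le> n + (n - 2) div d"
proof -
  let ?J = "{j \<in> {1..n - 1}. d dvd j \<or> j = n - 1}"
  define q where "q = (n - 2) div d"
  \<comment> \<open>Run \<open>i\<close> ends at \<open>i * d\<close>, but the last one may be cut
    off at \<open>n - 1\<close>.\<close>
  have "?J \<subseteq> (\<lambda>i. min (n - 1) (i * d)) ` {1..q + 1}"
  proof
    fix j assume j: "j \<in> ?J"
    have lt: "n - 2 < (q + 1) * d"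
      using assms dividend_less_div_times[of d "n - 2"] by (simp add: q_def algebra_simps)
    show "j \<in> (\<lambda>i. min (n - 1) (i * d)) ` {1..q + 1}"
    proof (cases "j = n - 1")
      case True
      then show ?thesis using lt by (intro image_eqI[of _ _ "q + 1"]) auto
    next
      case False
      then obtain i where i: "j = i * d" using j by (auto elim: dvdE simp: mult.commute)
      have "i * d \<le> n - 2" using i j False by auto
      then have "i \<le> q" using assms by (simp add: q_def less_eq_div_iff_mult_less_eq)
      then show ?thesis using i j by (intro image_eqI[of _ _ i]) auto
    qed
  qed
  then have "card ?J \<le> card ((\<lambda>i. min (n - 1) (i * d)) ` {1..q + 1})"
    by (rule card_mono[rotated]) auto
  also have "\<dots> \<le> q + 1"
    using card_image_le[of "{1..q + 1}"] by auto
  finally have "card ?J \<le> q + 1" .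
  moreover have "card (parcs (flower n d)) \<le> card {..<n - 1} + card ?J"
    unfolding flower_def pair_pre_digraph.simps
    by (intro order_trans[OF card_Un_le] add_mono card_image_le) auto
  ultimately show ?thesis using assms by (simp add: q_def)
qed

text \<open>The position of a vertex on its cycle; every arc that does not end in 0 raises it by 1.\<close>
definition flower_height :: "nat \<Rightarrow> nat \<Rightarrow> nat" where
  "flower_height d j = (if j = 0 then 0 else Suc ((j - 1) mod d))"

lemma flower_height_le: "1 \<le> d \<Longrightarrow> flower_height d j \<le> d"
  by (auto simp: flower_height_def Suc_le_eq)

lemma flower_height_arc:
  assumes "(x, y) \<in> parcs (flower n d)" "y \<noteq> 0"
  shows "flower_height d y = Suc (flower_height d x)"
proof -
  obtain j where j: "x = (if d dvd j then 0 else j)" "y = Suc j"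
    using assms by (auto simp: flower_def)
  show ?thesis
  proof (cases "d dvd j")
    case True
    then show ?thesis using j by (simp add: flower_height_def)
  next
    case False
    \<comment> \<open>Now \<open>j\<close> and \<open>Suc j\<close> lie in the same run, so the
      remainder does not wrap around.\<close>
    then obtain i where "j = Suc i" by (cases j) auto
    then show ?thesis using j False by (auto simp: flower_height_def mod_Suc dvd_eq_mod_eq_0)
  qed
qed

lemma flower_height_awalk:
  assumes "pre_digraph.awalk (flower n d) u p v" "0 \<notin> snd ` set p"
  shows "flower_height d v = flower_height d u + length p"
proof -
  interpret pair_fin_digraph "flower n d" by (rule pair_fin_digraph_flower)
  show ?thesis
    using assms
  proof (induct p arbitrary: u)
    case Nil
    then show ?case by (simp add: awalk_Nil_iff)
  next
    case (Cons e p)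
    then show ?case
      using flower_height_arc[of "fst e" "snd e" n d] by (auto simp: awalk_Cons_iff)
  qed
qed

text \<open>Rotated to start at 0, a cycle gains one unit of height per arc until its only arc
  \<open>(x, 0)\<close> into 0, so its length is the height of \<open>x\<close> plus 1.\<close>

lemma flower_cycle_length:
  assumes "1 \<le> d" "pre_digraph.cycle (flower n d) p"
  shows "length p \<le> Suc d"
proof -
  interpret pair_fin_digraph "flower n d" by (rule pair_fin_digraph_flower)
  obtain u where u: "awalk u p u" "distinct (tl (awalk_verts u p))" "p \<noteq> []"
    using assms(2) unfolding cycle_def by auto
  have "tl (awalk_verts u p) = map snd p"
    by (rule tl_awalk_verts[OF u(1,3)])
  then have dist: "distinct (map snd p)" using u(2) by simp
  \<comment> \<open>Otherwise one turn around the cycle would raise the height of \<open>u\<close>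
    above itself.\<close>
  have "0 \<in> snd ` set p"
    using flower_height_awalk[OF u(1)] u(3) by auto
  then obtain x p1 p2 where p: "p = p1 @ (x, 0) # p2"
    by (auto dest!: split_list)
  have w: "awalk u p1 x" "awalk 0 p2 u"
    using u(1) unfolding p by (auto simp: awalk_Cons_iff)
  have "0 \<notin> snd ` set p1" "0 \<notin> snd ` set p2"
    using dist unfolding p by auto
  \<comment> \<open>The walk \<open>p2\<close> climbs from 0 to \<open>u\<close>, and
    \<open>p1\<close> from \<open>u\<close> to \<open>x\<close>.\<close>
  then have "flower_height d x = length p2 + length p1"
    using flower_height_awalk[OF w(1)] flower_height_awalk[OF w(2)]
    by (simp add: flower_height_def)
  then show ?thesis using flower_height_le[OF assms(1), of x] by (simp add: p)
qed

text \<open>The first run is full because \<open>d < n\<close>; together with 0 it forms the cycle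
  0, 1, ..., \<open>d\<close>, 0.\<close>

lemma flower_petal:
  assumes "1 \<le> d" "d < n"
  shows "\<exists>p. pre_digraph.cycle (flower n d) p \<and> length p = Suc d"
proof -
  interpret pair_fin_digraph "flower n d" by (rule pair_fin_digraph_flower)
  let ?p = "\<lambda>m. map (\<lambda>j. (j, Suc j)) [0..<m]"
  have arc: "(j, Suc j) \<in> parcs (flower n d)" if "j < d" for j
  proof -
    \<comment> \<open>Where the definition replaces the source \<open>j\<close> by 0,
      \<open>j\<close> is 0 already.\<close>
    have "d dvd j \<longleftrightarrow> j = 0" using that by (auto dest: dvd_imp_le)
    then show ?thesis
      using that assms by (auto simp: flower_def intro!: image_eqI[of _ _ j])
  qed
  have walk: "awalk 0 (?p m) m" if "m \<le> d" for m
    using that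
  proof (induct m)
    case 0
    then show ?case using assms by (simp add: awalk_Nil_iff)
  next
    case (Suc m)
    have "awalk 0 (?p m) m" "awalk m [(m, Suc m)] (Suc m)"
      using Suc arc[of m] assms by (auto simp: awalk_simps)
    then have "awalk 0 (?p m @ [(m, Suc m)]) (Suc m)" by (rule awalk_appendI)
    then show ?case by simp
  qed
  have "(d, 0) \<in> parcs (flower n d)" using assms by (auto simp: flower_def)
  then have "awalk d [(d, 0)] 0" using assms by (auto simp: awalk_simps)
  then have c: "awalk 0 (?p d @ [(d, 0)]) 0"
    using walk[of d] by (intro awalk_appendI) auto
  have "tl (awalk_verts 0 (?p d @ [(d, 0)])) = map snd (?p d @ [(d, 0)])"
    by (rule tl_awalk_verts[OF c]) simp
  moreover have "distinct (map snd (?p d @ [(d, 0)]))"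
    by (auto simp: distinct_map comp_def inj_on_def)
  ultimately have "cycle (?p d @ [(d, 0)])"
    using c unfolding cycle_def by auto
  then show ?thesis by (intro exI[of _ "?p d @ [(d, 0)]"]) simp
qed

lemma circumference_flower:
  assumes "1 \<le> d" "d < n"
  shows "circumference (flower n d) = Suc d"
  unfolding circumference_def
proof (rule cSup_eq_maximum)
  show "Suc d \<in> length ` Collect (pre_digraph.cycle (flower n d))"
    using flower_petal[OF assms] by force
qed (use flower_cycle_length[OF assms(1)] in auto)

text \<open>Each nonzero vertex is entered from 0 or from its predecessor; conversely, climbing a
  run ends at an arc back to 0.\<close>

lemma strongly_connected_flower:
  assumes "1 \<le> n"
  shows "strongly_connected (flower n d)"
proof -
  interpret pair_fin_digraph "flower n d" by (rule pair_fin_digraph_flower)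
  have from0: "0 \<rightarrow>\<^sup>*\<^bsub>flower n d\<^esub> j" if "j < n" for j
    using that
  proof (induct j)
    case 0
    then show ?case by simp
  next
    case (Suc j)
    let ?x = "if d dvd j then 0 else j"
    have "(?x, Suc j) \<in> parcs (flower n d)"
      using Suc.prems unfolding flower_def by (auto intro!: image_eqI[of _ _ j])
    moreover have "0 \<rightarrow>\<^sup>*\<^bsub>flower n d\<^esub> ?x" using Suc by auto
    ultimately show ?case by (auto intro: reachable_adj_trans split: if_splits)
  qed
  have to0: "j \<rightarrow>\<^sup>*\<^bsub>flower n d\<^esub> 0" if "j < n" for j
    using that
  proof (induct "n - j" arbitrary: j rule: less_induct)
    case less
    consider "j = 0" | "j \<noteq> 0" "d dvd j \<or> j = n - 1" | "\<not> d dvd j" "j < n - 1"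
      using less.prems by fastforce
    then show ?case
    proof cases
      case 1
      then show ?thesis using less.prems by simp
    next
      case 2
      then have "(j, 0) \<in> parcs (flower n d)" using less.prems by (auto simp: flower_def)
      then show ?thesis by auto
    next
      case 3
      then have "(j, Suc j) \<in> parcs (flower n d)"
        by (auto simp: flower_def intro!: image_eqI[of _ _ j])
      moreover have "Suc j \<rightarrow>\<^sup>*\<^bsub>flower n d\<^esub> 0" using 3 by (intro less.hyps) auto
      ultimately show ?thesis by (auto intro: adj_reachable_trans)
    qed
  qed
  show ?thesis
  proof
    show "verts (flower n d) \<noteq> {}" using assms by (simp add: lessThan_empty_iff)
  next
    fix u v assume "u \<in> verts (flower n d)" "v \<in> verts (flower n d)"
    then show "u \<rightarrow>\<^sup>*\<^bsub>flower n d\<^esub> v" using from0 to0 by (auto intro: reachable_trans)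
  qed
qed

theorem theorem3:
  fixes k n :: nat
  assumes "2 \<le> k" and "k \<le> n"
  shows "(\<forall>G :: 'a pair_pre_digraph.
            pair_fin_digraph G \<and> strongly_connected G \<and> card (pverts G) = n \<and>
            circumference G = k \<longrightarrow> card (parcs G) \<ge> min_arcs n k)
       \<and> (\<exists>G0 :: nat pair_pre_digraph.
            pair_fin_digraph G0 \<and> strongly_connected G0 \<and> card (pverts G0) = n \<and>
            circumference G0 = k \<and> card (parcs G0) = min_arcs n k)"
proof -
  \<comment> \<open>The type variable \<open>'b\<close> is generalised, so the fact applies to
    \<open>'a\<close> and also to the \<open>nat\<close> vertices of \<open>?F\<close>.\<close>
  have lower: "min_arcs n k \<le> card (parcs G)"
    if "pair_fin_digraph G" "strongly_connected G" "card (pverts G) = n" "circumference G = k"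
    for G :: "'b pair_pre_digraph"
  proof -
    interpret pair_fin_digraph G by fact
    show ?thesis using card_arcs_ge[of k] that assms by simp
  qed
  \<comment> \<open>Runs of length \<open>k - 1\<close> together with 0 give cycles of length
    \<open>k\<close>.\<close>
  let ?F = "flower n (k - 1)"
  have F: "pair_fin_digraph ?F" "strongly_connected ?F" "card (pverts ?F) = n"
    "circumference ?F = k"
    using assms pair_fin_digraph_flower strongly_connected_flower circumference_flower[of "k - 1" n]
    by auto
  moreover have "card (parcs ?F) \<le> min_arcs n k"
    using card_parcs_flower_le[of n "k - 1"] min_arcs_conv[OF assms] assms by simp
  ultimately show ?thesis using lower by (metis le_antisym)
qed

end
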